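(* Let $i:A\hookrightarrow B$ be a weak injective morphism between finite Archimedean interval effect algebras, and let $\sigma:A\to[0,1]$ be a state. Let $j:\mathrm{St}(A)\to\mathrm{HC}^1(A)$ be the embedding given by $j(\rho)=\rho-\sigma_0$ for some fixed state $\sigma_0$ on $A$, and let $\partial:\mathrm{HC}^1(A)\to\mathrm{HC}^2(B,A)$ be the connecting homomorphism of the long exact sequence of the pair $(B,A)$. If $\sigma$ extends to a state $\tau:B\to[0,1]$ for which $\tau\circ i=\sigma$, then the cohomology class $\partial(j(\sigma))\in\mathrm{HC}^2(B,A)$ is zero.
   Context: An effect algebra is a set $A$ with a partial binary operation $\boxplus$, a unary operation $(-)^\bot$ and elements $0,1\in A$ such that: if $a\boxplus b$ is defined then so is $b\boxplus a$ and they are equal; if $a\boxplus b$ and $(a\boxplus b)\boxplus c$ are defined then so are $b\boxplus c$ and $a\boxplus(b\boxplus c)$, and $(a\boxplus b)\boxplus c=a\boxplus(b\boxplus c)$; $0\boxplus a$ is always defined and equals $a$; for each $a$, $a^\bot$ is the unique element with $a\boxplus a^\bot=1$; if $a\boxplus 1$ is defined then $a=0$. A (weak) morphism preserves $0$, $1$, complements, and whenever $a\boxplus b$ is defined, $f(a)\boxplus f(b)$ is defined and equals $f(a\boxplus b)$. A state on $A$ is a morphism $A\to[0,1]$, where $[0,1]\subseteq\mathbb{R}$ has partial addition and $a^\bot=1-a$; $\mathrm{St}(A)$ is the set of states. An ordered abelian group is an abelian group with a partial order compatible with addition; it is Archimedean if whenever $nx\le y$ for all $n\in\mathbb{N}$,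 then $x\le0$. For a positive element $u$ of an ordered abelian group, $[0,u]$ is an effect algebra with partial addition and $a^\bot=u-a$; an effect algebra isomorphic to such an interval is an interval effect algebra, and it is called Archimedean if its ambient group is Archimedean. Cyclic cohomology: for $n\ge 0$ let $T_n(A)=\{(a_0,\dots,a_n)\in A^{n+1}\mid a_0\boxplus\cdots\boxplus a_n \text{ is defined and equals } 1\}$. Let $C^n(A)=\mathbb{R}^{T_n(A)}$ with coboundary $$\delta^n(\alpha)(a_0,\dots,a_{n+1})=\sum_{k=0}^{n}(-1)^k\alpha(a_0,\dots,a_k\boxplus a_{k+1},\dots,a_{n+1})+(-1)^{n+1}\alpha(a_{n+1}\boxplus a_0,a_1,\dots,a_n).$$ Let $C^n_\lambda(A)\subseteq C^n(A)$ be the subspace of $\alpha$ with $\alpha(a_0,\dots,a_n)=(-1)^n\alpha(a_n,a_0,\dots,a_{n-1})$ for all $(a_0,\dots,a_n)\in T_n(A)$; these form a subcomplex, and $\mathrm{HC}^n(A)$ is the $n$-th cohomology of $C_\lambda^\bullet(A)$. Identifying $(a_0,a_1)\in T_1(A)$ with $a_1\in A$, $\mathrm{HC}^1(A)$ is identified with the space of maps $\alpha:A\to\mathbb{R}$ that are additive on defined sums and satisfy $\alpha(a^\bot)=-\alpha(a)$; thus a difference of two states on $A$ is an element of $\mathrm{HC}^1(A)$. Relative cohomology: the injective morphism $i$ regards $T_n(A)$ as a subset of $T_n(B)$ (applying $i$ entrywise), giving a surjective restriction cochain map $p^\bullet:C_\lambda^\bullet(B)\to C_\lambda^\bullet(A)$.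 $\mathrm{HC}^n(B,A)$ is the $n$-th cohomology of $\ker(p^\bullet)$, and the short exact sequence $0\to\ker(p^\bullet)\to C_\lambda^\bullet(B)\to C_\lambda^\bullet(A)\to0$ induces the long exact sequence of the pair $(B,A)$, $\cdots\to\mathrm{HC}^1(B)\to\mathrm{HC}^1(A)\xrightarrow{\partial}\mathrm{HC}^2(B,A)\to\mathrm{HC}^2(B)\to\cdots$.
   Formalization: The claim fails for an arbitrary fixed state σ₀ (A=[0,(1,1)] in ℤ², B=[0,3] in ℤ); it is proved for every σ₀ that itself extends to a state on B, and some σ₀ is shown to work for all σ at once. *)

theory Defs
  imports Complex_Main "HOL-Algebra.Coset"
begin

section \<open>Effect algebras\<close>

text \<open>
  The partial sum is option-valued, with \<^term>\<open>None\<close> for ``undefined''. Its values on arguments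
  outside the carrier are irrelevant.
\<close>

record 'a effect = "'a partial_object" +
  esum :: "'a \<Rightarrow> 'a \<Rightarrow> 'a option"
  ecomp :: "'a \<Rightarrow> 'a"
  ezero :: 'a
  eone :: 'a

locale effect_algebra =
  fixes A :: "'a effect"
  assumes zero_closed: "ezero A \<in> carrier A"
    and one_closed: "eone A \<in> carrier A"
    and comp_closed: "a \<in> carrier A \<Longrightarrow> ecomp A a \<in> carrier A"
    and sum_closed: "\<lbrakk>a \<in> carrier A; b \<in> carrier A; esum A a b = Some c\<rbrakk> \<Longrightarrow> c \<in> carrier A"
    and sum_comm: "\<lbrakk>a \<in> carrier A; b \<in> carrier A; esum A a b = Some c\<rbrakk> \<Longrightarrow> esum A b a = Some c"
    and sum_assoc: "\<lbrakk>a \<in> carrier A; b \<in> carrier A; c \<in> carrier A;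
        esum A a b = Some d; esum A d c = Some e\<rbrakk>
      \<Longrightarrow> \<exists>f. esum A b c = Some f \<and> esum A a f = Some e"
    and zero_sum: "a \<in> carrier A \<Longrightarrow> esum A (ezero A) a = Some a"
    and sum_comp: "a \<in> carrier A \<Longrightarrow> esum A a (ecomp A a) = Some (eone A)"
    and comp_unique: "\<lbrakk>a \<in> carrier A; b \<in> carrier A; esum A a b = Some (eone A)\<rbrakk>
      \<Longrightarrow> b = ecomp A a"
    and zero_one_law: "\<lbrakk>a \<in> carrier A; esum A a (eone A) \<noteq> None\<rbrakk> \<Longrightarrow> a = ezero A"

definition effect_mor :: "'a effect \<Rightarrow> 'b effect \<Rightarrow> ('a \<Rightarrow> 'b) set" where
  "effect_mor A B = {f. f \<in> carrier A \<rightarrow> carrier B \<and>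
     f (ezero A) = ezero B \<and> f (eone A) = eone B \<and>
     (\<forall>a\<in>carrier A. f (ecomp A a) = ecomp B (f a)) \<and>
     (\<forall>a\<in>carrier A. \<forall>b\<in>carrier A. \<forall>c. esum A a b = Some c \<longrightarrow> esum B (f a) (f b) = Some (f c))}"

definition effect_iso :: "'a effect \<Rightarrow> 'b effect \<Rightarrow> ('a \<Rightarrow> 'b) set" where
  "effect_iso A B = {f \<in> effect_mor A B. bij_betw f (carrier A) (carrier B) \<and>
     inv_into (carrier A) f \<in> effect_mor B A}"

definition interval_effect :: "'g::ordered_ab_group_add \<Rightarrow> 'g effect" where
  "interval_effect u = \<lparr>carrier = {0..u},
     esum = (\<lambda>a b. if a + b \<le> u then Some (a + b) else None),
     ecomp = (\<lambda>a. u - a), ezero = 0, eone = u\<rparr>"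

lemma effect_algebra_interval:
  fixes u :: "'g::ordered_ab_group_add"
  assumes "0 \<le> u"
  shows "effect_algebra (interval_effect u)"
proof
  fix a b c d e :: 'g
  assume "a \<in> carrier (interval_effect u)" "b \<in> carrier (interval_effect u)"
    "c \<in> carrier (interval_effect u)" "esum (interval_effect u) a b = Some d"
    "esum (interval_effect u) d c = Some e"
  then have *: "0 \<le> a" "d = a + b" "a + b + c \<le> u" "e = a + b + c"
    by (auto simp: interval_effect_def split: if_splits)
  have "b + c \<le> a + b + c"
    using *(1) by (simp add: add.assoc)
  with *(3) have "b + c \<le> u"
    by (rule order_trans[rotated])
  with * show "\<exists>f. esum (interval_effect u) b c = Some f \<and> esum (interval_effect u) a f = Some e"
    by (simp add: interval_effect_def add.assoc)
qed (use assms in \<open>auto simp: interval_effect_def add.commute eq_diff_eq split: if_splits\<close>)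

definition archimedean_group :: "'g::ordered_ab_group_add itself \<Rightarrow> bool" where
  "archimedean_group (_ :: 'g itself) \<longleftrightarrow>
     (\<forall>x y :: 'g. (\<forall>n::nat. (\<Sum>k<n. x) \<le> y) \<longrightarrow> x \<le> 0)"

text \<open>
  The ambient ordered group is the type argument, so a hypothesis
  \<open>archimedean_interval_effect_algebra TYPE('g) A\<close> with \<open>'g\<close> a free type variable amounts to the
  existence of a suitable ambient group.
\<close>

definition archimedean_interval_effect_algebra ::
  "'g::ordered_ab_group_add itself \<Rightarrow> 'a effect \<Rightarrow> bool" where
  "archimedean_interval_effect_algebra (_ :: 'g itself) A \<longleftrightarrow>
     archimedean_group TYPE('g) \<and> effect_algebra A \<and>
     (\<exists>u::'g. 0 \<le> u \<and> effect_iso A (interval_effect u) \<noteq> {})"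

definition states :: "'a effect \<Rightarrow> ('a \<Rightarrow> real) set" where
  "states A = effect_mor A (interval_effect 1)"

definition extends_to_state :: "'a effect \<Rightarrow> 'b effect \<Rightarrow> ('a \<Rightarrow> 'b) \<Rightarrow> ('a \<Rightarrow> real) \<Rightarrow> bool" where
  "extends_to_state A B i \<sigma> \<longleftrightarrow> (\<exists>\<tau>\<in>states B. \<forall>a\<in>carrier A. \<tau> (i a) = \<sigma> a)"

section \<open>Cohomology of a cochain complex of abelian groups\<close>

definition cocycles :: "(nat \<Rightarrow> 'c monoid) \<Rightarrow> (nat \<Rightarrow> 'c \<Rightarrow> 'c) \<Rightarrow> nat \<Rightarrow> 'c set" where
  "cocycles C d n = kernel (C n) (C (Suc n)) (d n)"

definition coboundaries :: "(nat \<Rightarrow> 'c monoid) \<Rightarrow> (nat \<Rightarrow> 'c \<Rightarrow> 'c) \<Rightarrow> nat \<Rightarrow> 'c set" where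
  "coboundaries C d n = (case n of 0 \<Rightarrow> {\<one>\<^bsub>C 0\<^esub>} | Suc m \<Rightarrow> d m ` carrier (C m))"

definition cohomology :: "(nat \<Rightarrow> 'c monoid) \<Rightarrow> (nat \<Rightarrow> 'c \<Rightarrow> 'c) \<Rightarrow> nat \<Rightarrow> 'c set monoid" where
  "cohomology C d n = (C n)\<lparr>carrier := cocycles C d n\<rparr> Mod coboundaries C d n"

definition cohomology_class :: "(nat \<Rightarrow> 'c monoid) \<Rightarrow> (nat \<Rightarrow> 'c \<Rightarrow> 'c) \<Rightarrow> nat \<Rightarrow> 'c \<Rightarrow> 'c set" where
  "cohomology_class C d n x = coboundaries C d n #>\<^bsub>(C n)\<lparr>carrier := cocycles C d n\<rparr>\<^esub> x"

section \<open>Cyclic cohomology of an effect algebra\<close>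

fun esum_list :: "'a effect \<Rightarrow> 'a list \<Rightarrow> 'a option" where
  "esum_list A [] = Some (ezero A)"
| "esum_list A (a # as) = Option.bind (esum_list A as) (esum A a)"

definition tests :: "'a effect \<Rightarrow> nat \<Rightarrow> 'a list set" where
  "tests A n = {as. length as = Suc n \<and> set as \<subseteq> carrier A \<and> esum_list A as = Some (eone A)}"

text \<open>Real functions on the set of tests are represented by functions on all lists that vanish
  off the tests.\<close>

definition cochains :: "'a effect \<Rightarrow> nat \<Rightarrow> ('a list \<Rightarrow> real) set" where
  "cochains A n = {\<alpha>. \<forall>as. as \<notin> tests A n \<longrightarrow> \<alpha> as = 0}"

text \<open>\<open>merge A k (a\<^sub>0,\<dots>,a\<^sub>m) = (a\<^sub>0,\<dots>,a\<^sub>k \<boxplus> a\<^sub>k\<^sub>+\<^sub>1,\<dots>,a\<^sub>m)\<close> and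
  \<open>merge_cyclic A (a\<^sub>0,\<dots>,a\<^sub>m) = (a\<^sub>m \<boxplus> a\<^sub>0,a\<^sub>1,\<dots>,a\<^sub>m\<^sub>-\<^sub>1)\<close>.\<close>

definition merge :: "'a effect \<Rightarrow> nat \<Rightarrow> 'a list \<Rightarrow> 'a list" where
  "merge A k as = take k as @ the (esum A (as ! k) (as ! Suc k)) # drop (k + 2) as"

definition merge_cyclic :: "'a effect \<Rightarrow> 'a list \<Rightarrow> 'a list" where
  "merge_cyclic A as = the (esum A (last as) (hd as)) # butlast (tl as)"

definition coboundary :: "'a effect \<Rightarrow> nat \<Rightarrow> ('a list \<Rightarrow> real) \<Rightarrow> 'a list \<Rightarrow> real" where
  "coboundary A n \<alpha> = (\<lambda>as. if as \<in> tests A (Suc n)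
     then (\<Sum>k\<le>n. (-1) ^ k * \<alpha> (merge A k as)) + (-1) ^ Suc n * \<alpha> (merge_cyclic A as)
     else 0)"

definition cyclic_cochains :: "'a effect \<Rightarrow> nat \<Rightarrow> ('a list \<Rightarrow> real) set" where
  "cyclic_cochains A n =
     {\<alpha> \<in> cochains A n. \<forall>as\<in>tests A n. \<alpha> as = (-1) ^ n * \<alpha> (last as # butlast as)}"

definition cyclic_complex :: "'a effect \<Rightarrow> nat \<Rightarrow> ('a list \<Rightarrow> real) monoid" where
  "cyclic_complex A n = \<lparr>carrier = cyclic_cochains A n,
     monoid.mult = (\<lambda>\<alpha> \<beta> as. \<alpha> as + \<beta> as), one = (\<lambda>_. 0)\<rparr>"

abbreviation HC :: "nat \<Rightarrow> 'a effect \<Rightarrow> ('a list \<Rightarrow> real) set monoid" where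
  "HC n A \<equiv> cohomology (cyclic_complex A) (coboundary A) n"

section \<open>Relative cohomology and the connecting homomorphism\<close>

definition restriction ::
  "'a effect \<Rightarrow> ('a \<Rightarrow> 'b) \<Rightarrow> nat \<Rightarrow> ('b list \<Rightarrow> real) \<Rightarrow> 'a list \<Rightarrow> real" where
  "restriction A i n \<beta> = (\<lambda>as. if as \<in> tests A n then \<beta> (map i as) else 0)"

definition relative_complex ::
  "'b effect \<Rightarrow> 'a effect \<Rightarrow> ('a \<Rightarrow> 'b) \<Rightarrow> nat \<Rightarrow> ('b list \<Rightarrow> real) monoid" where
  "relative_complex B A i n = (cyclic_complex B n)\<lparr>carrier :=
     kernel (cyclic_complex B n) (cyclic_complex A n) (restriction A i n)\<rparr>"

abbreviation HC_rel ::
  "nat \<Rightarrow> 'b effect \<Rightarrow> 'a effect \<Rightarrow> ('a \<Rightarrow> 'b) \<Rightarrow> ('b list \<Rightarrow> real) set monoid" where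
  "HC_rel n B A i \<equiv> cohomology (relative_complex B A i) (coboundary B) n"

text \<open>The connecting homomorphism sends the class of a cocycle \<open>\<alpha>\<close> to the class of \<open>\<delta>\<beta>\<close> for any
  cyclic cochain \<open>\<beta>\<close> lifting a representative of that class.\<close>

definition connecting ::
  "'b effect \<Rightarrow> 'a effect \<Rightarrow> ('a \<Rightarrow> 'b) \<Rightarrow> nat \<Rightarrow> ('a list \<Rightarrow> real) set \<Rightarrow> ('b list \<Rightarrow> real) set" where
  "connecting B A i n X = (THE Y. \<exists>\<beta>\<in>carrier (cyclic_complex B n). restriction A i n \<beta> \<in> X \<and>
     Y = cohomology_class (relative_complex B A i) (coboundary B) (Suc n) (coboundary B n \<beta>))"

text \<open>
  A map on the carrier is regarded as a 1-cochain through \<open>(a\<^sub>0, a\<^sub>1) \<mapsto> a\<^sub>1\<close>. The base point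
  matters: if \<open>\<sigma>\<^sub>0\<close> does not extend to \<open>B\<close>, then \<open>\<rho> - \<sigma>\<^sub>0\<close> need not lie in the image of \<open>HC 1 B\<close>
  even when \<open>\<rho>\<close> extends. Example: \<open>A = [0,(1,1)]\<close> in the group of integer pairs, \<open>B = [0,3]\<close> in the
  integers, \<open>i (1,0) = 1\<close>, \<open>i (0,1) = 2\<close>; here \<open>HC 1 B\<close> is zero, and the only state of \<open>A\<close> that extends
  takes the value 1/3 at (1,0).
\<close>

definition one_cochain :: "'a effect \<Rightarrow> ('a \<Rightarrow> real) \<Rightarrow> 'a list \<Rightarrow> real" where
  "one_cochain A f = (\<lambda>as. if as \<in> tests A 1 then f (as ! 1) else 0)"

definition state_embedding :: "'a effect \<Rightarrow> ('a \<Rightarrow> real) \<Rightarrow> ('a \<Rightarrow> real) \<Rightarrow> ('a list \<Rightarrow> real) set" where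
  "state_embedding A \<sigma>\<^sub>0 \<rho> =
     cohomology_class (cyclic_complex A) (coboundary A) 1 (one_cochain A (\<lambda>a. \<rho> a - \<sigma>\<^sub>0 a))"

end

theory Submission
  imports Defs
begin

text \<open>If both states extend to \<open>B\<close>, the difference of the extensions is a cyclic 1-cocycle on \<open>B\<close>
  lifting \<open>\<sigma> - \<sigma>\<^sub>0\<close>, and \<open>\<partial>\<close> kills classes that lift. The coboundary \<open>C\<^sup>0 \<rightarrow> C\<^sup>1\<close> vanishes by
  commutativity, so two lifts of the same class differ by a relative cochain and \<open>\<partial>\<close> is well
  defined. If no state of \<open>A\<close> extends, any base point works vacuously.\<close>

context effect_algebra
begin

text \<open>Needed because \<open>esum_list\<close> brackets to the right and ends in
  \<open>ezero A\<close>, so unfolding a test leaves a zero as right summand, while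
  \<open>zero_sum\<close> has it on the left.\<close>

lemma sum_zero: "a \<in> carrier A \<Longrightarrow> esum A a (ezero A) = Some a"
  using sum_comm zero_closed zero_sum by blast

lemma tests_1: "as \<in> tests A 1 \<longleftrightarrow>
    (\<exists>a b. as = [a, b] \<and> a \<in> carrier A \<and> b \<in> carrier A \<and> esum A a b = Some (eone A))"
  by (auto simp: tests_def length_Suc_conv sum_zero)

lemma tests_2: "as \<in> tests A 2 \<longleftrightarrow>
    (\<exists>a b c d. as = [a, b, c] \<and> a \<in> carrier A \<and> b \<in> carrier A \<and> c \<in> carrier A \<and>
      esum A b c = Some d \<and> esum A a d = Some (eone A))"
  by (auto simp: tests_def length_Suc_conv sum_zero eval_nat_numeral bind_eq_Some_conv)

text \<open>At a test \<open>[a, b]\<close> the two terms are \<gamma> at the one-entry list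
  \<open>[eone A]\<close>, with opposite signs. Hence the cohomology class of a 1-cocycle has only
  one member.\<close>

lemma coboundary_0: "coboundary A 0 \<gamma> = (\<lambda>_. 0)"
proof
  fix as
  show "coboundary A 0 \<gamma> as = 0"
  proof (cases "as \<in> tests A 1")
    case True
    then obtain a b where ab: "as = [a, b]" "a \<in> carrier A" "b \<in> carrier A"
      "esum A a b = Some (eone A)"
      using tests_1 by blast
    then have "esum A b a = Some (eone A)"
      using sum_comm by blast
    with ab True show ?thesis
      by (simp add: coboundary_def merge_def merge_cyclic_def)
  qed (simp add: coboundary_def)
qed

text \<open>In a test \<open>[a, b]\<close> the entry \<open>b\<close> is the complement of
  \<open>a\<close>, and rotation swaps the two. Cyclic symmetry with sign -1 is therefore oddness of
  \<open>f\<close> under complements.\<close>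

lemma one_cochain_cyclic:
  assumes "\<And>a. a \<in> carrier A \<Longrightarrow> f (ecomp A a) = - f a"
  shows "one_cochain A f \<in> cyclic_cochains A 1"
proof -
  have "one_cochain A f as = - one_cochain A f (last as # butlast as)" if "as \<in> tests A 1" for as
  proof -
    obtain a b where ab: "as = [a, b]" "a \<in> carrier A" "b \<in> carrier A"
      "esum A a b = Some (eone A)"
      using \<open>as \<in> tests A 1\<close> tests_1 by blast
    then have "esum A b a = Some (eone A)" "b = ecomp A a"
      using sum_comm comp_unique by blast+
    with ab assms that show ?thesis
      by (simp add: one_cochain_def tests_1 del: One_nat_def)
  qed
  then show ?thesis
    by (auto simp: cyclic_cochains_def cochains_def one_cochain_def)
qed

text \<open>Since the cochain reads the second entry, its coboundary at \<open>[a, b, c]\<close> is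
  \<open>f c - f d + f b\<close>, where \<open>d\<close> is the sum of \<open>b\<close> and
  \<open>c\<close>.\<close>

lemma coboundary_one_cochain:
  assumes "\<And>a b c. \<lbrakk>a \<in> carrier A; b \<in> carrier A; esum A a b = Some c\<rbrakk> \<Longrightarrow> f c = f a + f b"
  shows "coboundary A 1 (one_cochain A f) = (\<lambda>_. 0)"
proof
  fix as
  show "coboundary A 1 (one_cochain A f) as = 0"
  proof (cases "as \<in> tests A 2")
    case True
    then obtain a b c d where abc: "as = [a, b, c]" "a \<in> carrier A" "b \<in> carrier A"
      "c \<in> carrier A" "esum A b c = Some d" "esum A a d = Some (eone A)"
      using tests_2 by blast
    then have d: "d \<in> carrier A" "esum A c b = Some d" "esum A d a = Some (eone A)"
      using sum_closed sum_comm by blast+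
    \<comment> \<open>Off the tests \<open>one_cochain\<close> takes the default value 0, so all
      three merged lists must be shown to be tests. The given bracketing yields only
      \<open>d\<close>; commuting and reassociating yields \<open>p\<close>, the sum of
      \<open>a\<close> and \<open>b\<close>, and then \<open>q\<close>, the sum of \<open>c\<close>
      and \<open>a\<close>.\<close>
    obtain p where p: "esum A b a = Some p" "esum A c p = Some (eone A)"
      using sum_assoc abc d by blast
    then have p': "p \<in> carrier A" "esum A a b = Some p" "esum A p c = Some (eone A)"
      using sum_closed sum_comm abc by blast+
    obtain q where q: "esum A c a = Some q" "esum A b q = Some (eone A)"
      using sum_assoc abc d by blast
    then have q': "q \<in> carrier A" "esum A q b = Some (eone A)"
      using sum_closed sum_comm abc by blast+
    have "one_cochain A f [p, c] = f c" "one_cochain A f [a, d] = f d"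
      "one_cochain A f [q, b] = f b"
      using abc d p' q' by (simp_all add: one_cochain_def tests_1 del: One_nat_def)
    moreover have "f d = f b + f c"
      using assms abc by blast
    ultimately show ?thesis
      using True abc p' q by (simp add: coboundary_def merge_def merge_cyclic_def)
  qed (simp add: coboundary_def numeral_2_eq_2)
qed

end

lemma coboundary_add:
  "coboundary A n (\<lambda>as. \<alpha> as + \<beta> as) = (\<lambda>as. coboundary A n \<alpha> as + coboundary A n \<beta> as)"
  by (auto simp: coboundary_def sum.distrib distrib_left)

lemma coboundary_diff:
  "coboundary A n (\<lambda>as. \<alpha> as - \<beta> as) = (\<lambda>as. coboundary A n \<alpha> as - coboundary A n \<beta> as)"
  by (auto simp: coboundary_def sum_subtractf right_diff_distrib)

lemma carrier_relative:
  "\<beta> \<in> carrier (relative_complex B A i n) \<longleftrightarrow>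
    \<beta> \<in> cyclic_cochains B n \<and> (\<forall>as\<in>tests A n. \<beta> (map i as) = 0)"
  by (auto simp: relative_complex_def kernel_def cyclic_complex_def restriction_def fun_eq_iff)

lemma relative_add:
  assumes "\<alpha> \<in> carrier (relative_complex B A i n)" "\<beta> \<in> carrier (relative_complex B A i n)"
  shows "(\<lambda>as. \<alpha> as + \<beta> as) \<in> carrier (relative_complex B A i n)"
  using assms by (auto simp: carrier_relative cyclic_cochains_def cochains_def distrib_left)

lemma relative_diff:
  assumes "\<alpha> \<in> carrier (relative_complex B A i n)" "\<beta> \<in> carrier (relative_complex B A i n)"
  shows "(\<lambda>as. \<alpha> as - \<beta> as) \<in> carrier (relative_complex B A i n)"
  using assms by (auto simp: carrier_relative cyclic_cochains_def cochains_def right_diff_distrib)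

text \<open>Translation by \<beta> is a bijection of the relative cochains, with inverse translation
  by -\<beta>. As the coboundary is additive, adding \<open>coboundary B n \<beta>\<close> maps the
  set of coboundaries onto itself.\<close>

lemma cohomology_class_coboundary:
  assumes "\<beta> \<in> carrier (relative_complex B A i n)"
  shows "cohomology_class (relative_complex B A i) (coboundary B) (Suc n) (coboundary B n \<beta>)
    = coboundaries (relative_complex B A i) (coboundary B) (Suc n)" (is "?L = ?R")
proof -
  have L: "?L = (\<lambda>\<gamma> as. coboundary B n \<gamma> as + coboundary B n \<beta> as) `
      carrier (relative_complex B A i n)"
    by (auto simp: cohomology_class_def r_coset_def coboundaries_def relative_complex_def
        cyclic_complex_def)
  have R: "?R = coboundary B n ` carrier (relative_complex B A i n)"
    by (simp add: coboundaries_def)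
  show ?thesis
  proof
    show "?L \<subseteq> ?R"
      unfolding L R
    proof (rule image_subsetI)
      fix \<gamma> assume "\<gamma> \<in> carrier (relative_complex B A i n)"
      from relative_add[OF this assms]
      show "(\<lambda>as. coboundary B n \<gamma> as + coboundary B n \<beta> as)
          \<in> coboundary B n ` carrier (relative_complex B A i n)"
        by (rule rev_image_eqI) (simp only: coboundary_add)
    qed
    show "?R \<subseteq> ?L"
      unfolding L R
    proof (rule image_subsetI)
      fix \<gamma> assume "\<gamma> \<in> carrier (relative_complex B A i n)"
      from relative_diff[OF this assms]
      show "coboundary B n \<gamma> \<in> (\<lambda>\<gamma> as. coboundary B n \<gamma> as + coboundary B n \<beta> as) `
          carrier (relative_complex B A i n)"
        by (rule rev_image_eqI) (simp only: coboundary_diff diff_add_cancel)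
    qed
  qed
qed

lemma connecting_eq_one:
  assumes "effect_algebra A" and \<beta>: "\<beta> \<in> cyclic_cochains B 1" "coboundary B 1 \<beta> = (\<lambda>_. 0)"
  shows "connecting B A i 1
      (cohomology_class (cyclic_complex A) (coboundary A) 1 (restriction A i 1 \<beta>))
    = \<one>\<^bsub>HC_rel 2 B A i\<^esub>" (is "connecting B A i 1 ?X = _")
proof -
  interpret effect_algebra A by fact
  \<comment> \<open>A cochain must exist for the image of the zero map to be the singleton of 0 and
    not empty.\<close>
  have "(\<lambda>_. 0) \<in> cyclic_cochains A 0"
    by (auto simp: cyclic_cochains_def cochains_def)
  then have "coboundaries (cyclic_complex A) (coboundary A) 1 = {\<lambda>_. 0}"
    by (auto simp: coboundaries_def coboundary_0 cyclic_complex_def)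
  then have X: "?X = {restriction A i 1 \<beta>}"
    by (simp add: cohomology_class_def r_coset_def cyclic_complex_def)
  \<comment> \<open>As \<open>?X\<close> is a singleton, any lift \<beta>' restricts exactly as
    \<beta> does. Then \<beta>' - \<beta> is a relative cochain, and its coboundary is that of
    \<beta>' because \<beta> is a cocycle.\<close>
  have lift: "cohomology_class (relative_complex B A i) (coboundary B) (Suc 1) (coboundary B 1 \<beta>')
      = coboundaries (relative_complex B A i) (coboundary B) (Suc 1)"
    if \<beta>': "\<beta>' \<in> cyclic_cochains B 1" "restriction A i 1 \<beta>' = restriction A i 1 \<beta>" for \<beta>'
  proof -
    have "\<beta>' (map i as) = \<beta> (map i as)" if "as \<in> tests A 1" for as
      using fun_cong[OF \<beta>'(2), of as] that by (simp add: restriction_def)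
    then have "(\<lambda>as. \<beta>' as - \<beta> as) \<in> carrier (relative_complex B A i 1)"
      using \<beta> \<beta>' by (auto simp: carrier_relative cyclic_cochains_def cochains_def)
    from cohomology_class_coboundary[OF this] show ?thesis
      by (simp add: coboundary_diff \<beta>(2) del: One_nat_def)
  qed
  \<comment> \<open>The definite description is well defined: \<beta> itself witnesses existence,
    and \<open>lift\<close> shows that every other lift gives the same coset.\<close>
  have "connecting B A i 1 ?X = coboundaries (relative_complex B A i) (coboundary B) (Suc 1)"
    unfolding connecting_def X
  proof (rule the_equality)
    show "\<exists>\<beta>'\<in>carrier (cyclic_complex B 1). restriction A i 1 \<beta>' \<in> {restriction A i 1 \<beta>} \<and>
        coboundaries (relative_complex B A i) (coboundary B) (Suc 1) =
        cohomology_class (relative_complex B A i) (coboundary B) (Suc 1) (coboundary B 1 \<beta>')"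
      using lift[OF \<beta>(1) refl] \<beta>(1) by (auto simp: cyclic_complex_def)
  qed (use lift in \<open>auto simp: cyclic_complex_def\<close>)
  \<comment> \<open>The unit of a factor group is the subgroup divided out, here the relative
    coboundaries.\<close>
  then show ?thesis
    by (simp add: cohomology_def FactGroup_def numeral_2_eq_2)
qed

text \<open>Ensures that a 1-cochain \<open>one_cochain B f\<close> is evaluated at
  \<open>map i as\<close> by its formula and not by its default value 0.\<close>

lemma (in effect_algebra) map_tests_1:
  assumes "effect_algebra B" "i \<in> effect_mor A B" "as \<in> tests A 1"
  shows "map i as \<in> tests B 1"
proof -
  obtain a b where ab: "as = [a, b]" "a \<in> carrier A" "b \<in> carrier A" "esum A a b = Some (eone A)"
    using assms(3) tests_1 by blast
  moreover have "i a \<in> carrier B" "i b \<in> carrier B" "esum B (i a) (i b) = Some (eone B)"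
    using assms(2) ab by (auto simp: effect_mor_def)
  ultimately show ?thesis
    by (simp add: effect_algebra.tests_1[OF assms(1)] del: One_nat_def)
qed

lemma state_comp: "\<lbrakk>\<tau> \<in> states A; a \<in> carrier A\<rbrakk> \<Longrightarrow> \<tau> (ecomp A a) = 1 - \<tau> a"
  by (simp add: states_def effect_mor_def interval_effect_def)

lemma state_sum:
  assumes "\<tau> \<in> states A" "a \<in> carrier A" "b \<in> carrier A" "esum A a b = Some c"
  shows "\<tau> c = \<tau> a + \<tau> b"
proof -
  have "esum (interval_effect 1) (\<tau> a) (\<tau> b) = Some (\<tau> c)"
    using assms unfolding states_def effect_mor_def by blast
  then show ?thesis
    by (simp add: interval_effect_def split: if_splits)
qed

lemma connecting_state_embedding:
  assumes "effect_algebra A" "effect_algebra B" "i \<in> effect_mor A B"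
    and "extends_to_state A B i \<sigma>\<^sub>0" "extends_to_state A B i \<sigma>"
  shows "connecting B A i 1 (state_embedding A \<sigma>\<^sub>0 \<sigma>) = \<one>\<^bsub>HC_rel 2 B A i\<^esub>"
proof -
  interpret A: effect_algebra A by fact
  interpret B: effect_algebra B by fact
  obtain \<tau>\<^sub>0 \<tau> where \<tau>: "\<tau>\<^sub>0 \<in> states B" "\<tau> \<in> states B"
      "\<forall>a\<in>carrier A. \<tau>\<^sub>0 (i a) = \<sigma>\<^sub>0 a" "\<forall>a\<in>carrier A. \<tau> (i a) = \<sigma> a"
    using assms(4,5) by (auto simp: extends_to_state_def)
  define \<beta> where "\<beta> = one_cochain B (\<lambda>b. \<tau> b - \<tau>\<^sub>0 b)"
  \<comment> \<open>A single state sends a complement to 1 minus its value; in the difference of two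
    states the constant 1 cancels, which leaves an odd function.\<close>
  have "\<beta> \<in> cyclic_cochains B 1"
    unfolding \<beta>_def using \<tau>(1,2) by (intro B.one_cochain_cyclic) (simp add: state_comp)
  moreover have "coboundary B 1 \<beta> = (\<lambda>_. 0)"
    unfolding \<beta>_def
  proof (rule B.coboundary_one_cochain)
    fix a b c assume "a \<in> carrier B" "b \<in> carrier B" "esum B a b = Some c"
    with \<tau>(1,2) show "\<tau> c - \<tau>\<^sub>0 c = (\<tau> a - \<tau>\<^sub>0 a) + (\<tau> b - \<tau>\<^sub>0 b)"
      by (simp add: state_sum[of _ B a b c])
  qed
  \<comment> \<open>At a test \<open>[a, b]\<close> both sides depend on the second entry only, and
    there \<tau> and \<open>\<tau>\<^sub>0\<close> at \<open>i b\<close> agree with \<sigma> and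
    \<open>\<sigma>\<^sub>0\<close> at \<open>b\<close>.\<close>
  moreover have "restriction A i 1 \<beta> = one_cochain A (\<lambda>a. \<sigma> a - \<sigma>\<^sub>0 a)"
  proof
    fix as
    show "restriction A i 1 \<beta> as = one_cochain A (\<lambda>a. \<sigma> a - \<sigma>\<^sub>0 a) as"
    proof (cases "as \<in> tests A 1")
      case True
      then obtain a b where "as = [a, b]" "b \<in> carrier A"
        using A.tests_1 by blast
      with True \<tau>(3,4) A.map_tests_1[OF assms(2,3) True] show ?thesis
        by (simp add: restriction_def one_cochain_def \<beta>_def)
    qed (simp add: restriction_def one_cochain_def)
  qed
  ultimately show ?thesis
    using connecting_eq_one[OF assms(1)] by (metis state_embedding_def)
qed

theorem theorem9p1:
  fixes A :: "'a effect" and B :: "'b effect" and i :: "'a \<Rightarrow> 'b"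
  assumes "finite (carrier A)"
    and "archimedean_interval_effect_algebra TYPE('g::ordered_ab_group_add) A"
    and "finite (carrier B)"
    and "archimedean_interval_effect_algebra TYPE('h::ordered_ab_group_add) B"
    and "i \<in> effect_mor A B"
    and "inj_on i (carrier A)"
    and "states A \<noteq> {}"
  shows "(\<exists>\<sigma>\<^sub>0\<in>states A. \<forall>\<sigma>\<in>states A. extends_to_state A B i \<sigma> \<longrightarrow>
            connecting B A i 1 (state_embedding A \<sigma>\<^sub>0 \<sigma>) = \<one>\<^bsub>HC_rel 2 B A i\<^esub>) \<and>
         (\<forall>\<sigma>\<^sub>0\<in>states A. extends_to_state A B i \<sigma>\<^sub>0 \<longrightarrow>
            (\<forall>\<sigma>\<in>states A. extends_to_state A B i \<sigma> \<longrightarrow>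
               connecting B A i 1 (state_embedding A \<sigma>\<^sub>0 \<sigma>) = \<one>\<^bsub>HC_rel 2 B A i\<^esub>))"
proof -
  have "effect_algebra A" "effect_algebra B"
    using assms(2,4) by (auto simp: archimedean_interval_effect_algebra_def)
  note connecting_state_embedding[OF this assms(5)]
  \<comment> \<open>For the first conjunct the base point is a state that extends, if there is one,
    and otherwise any element of \<open>states A\<close>.\<close>
  with assms(7) show ?thesis
    by blast
qed

end
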